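(* Let $A_1,A_2,A_3$ be a triangle with sides (lines) $a_1,a_2,a_3$ such that $A_i\notin a_i$ for $i\in\{1,2,3\}$. Through each vertex $A_i$ choose two lines $g_i,h_i$ such that $(a_ia_{i+1};g_{i+2}h_{i+2})$ is a harmonic pencil of lines for each $i\in\{1,2,3\}$ (indices taken cyclically modulo 3). Then: (i) If the lines $g_1,g_2,g_3$ are concurrent, then so is each triple $g_i,h_{i+1},h_{i+2}$ for $i\in\{1,2,3\}$. (ii) Conversely, if one of the triples $g_i,h_{i+1},h_{i+2}$ is concurrent, then so are the other two triples and the triple $g_1,g_2,g_3$. (iii) Each of the concurrencies in (i) and (ii) occurs if and only if $$\frac{A_1B_3}{B_3A_2}\cdot\frac{A_2B_1}{B_1A_3}\cdot\frac{A_3B_2}{B_2A_1}=1,$$ where $B_i=a_i\times g_i$.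
   Context: The setting is the real projective plane; for (iii) the vertices $A_1,A_2,A_3$ lie in the affine (Euclidean) part. For distinct lines $g,h$, $g\times h$ is their intersection point. A harmonic pencil $(gh;uv)$ consists of four distinct concurrent lines such that $v$ is the harmonic conjugate of $u$ with respect to $g$ and $h$ (cross-ratio $-1$ in the classical normalization). For collinear points, $\frac{AB}{CD}$ is the quotient of oriented lengths of the segments $AB$ and $CD$ on an oriented line; as usual, $\frac{AX}{XB}=-1$ if $X$ is the point at infinity of the line $AB$. Concurrency is meant projectively (the common point may be at infinity). *)

theory Defs
  imports "HOL-Analysis.Analysis"
begin

section \<open>The real projective plane\<close>

text \<open>Points and lines are the one- and two-dimensional subspaces of \<open>\<real>\<^sup>3\<close>.\<close>

typedef proj_point = "{S :: (real^3) set. subspace S \<and> dim S = 1}"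
proof
  show "span {axis 1 1 :: real^3} \<in> {S. subspace S \<and> dim S = 1}"
    by (simp add: axis_eq_0_iff)
qed

typedef proj_line = "{S :: (real^3) set. subspace S \<and> dim S = 2}"
proof
  show "{x :: real^3. axis 1 1 \<bullet> x = 0} \<in> {S. subspace S \<and> dim S = 2}"
    by (simp add: dim_hyperplane axis_eq_0_iff subspace_hyperplane)
qed

setup_lifting type_definition_proj_point
setup_lifting type_definition_proj_line

lift_definition incident :: "proj_point \<Rightarrow> proj_line \<Rightarrow> bool" is "(\<subseteq>)" .

definition meet :: "proj_line \<Rightarrow> proj_line \<Rightarrow> proj_point" where
  "meet g h = (THE P. incident P g \<and> incident P h)"

definition concurrent :: "proj_line \<Rightarrow> proj_line \<Rightarrow> proj_line \<Rightarrow> bool" where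
  "concurrent g h k \<longleftrightarrow> (\<exists>P. incident P g \<and> incident P h \<and> incident P k)"


section \<open>Cross-ratio and harmonic pencils\<close>

text \<open>\<open>line_coords n l\<close>: the vector \<open>n\<close> is a vector of homogeneous coordinates of the line \<open>l\<close>;
  \<open>n\<close> is determined by \<open>l\<close> up to a nonzero factor.\<close>

lift_definition line_coords :: "real^3 \<Rightarrow> proj_line \<Rightarrow> bool" is
  "\<lambda>n S. n \<noteq> 0 \<and> S = {x. n \<bullet> x = 0}" .

text \<open>Lines of the pencil spanned by \<open>g\<close> and \<open>h\<close> have coordinates \<open>\<alpha> a + \<beta> b\<close>, where \<open>a\<close> and
  \<open>b\<close> are coordinates of \<open>g\<close> and \<open>h\<close>. With \<open>u = \<alpha> a + \<beta> b\<close> and \<open>v = \<gamma> a + \<delta> b\<close>, the bracket formula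
  \<open>([g,u] [h,v]) / ([h,u] [g,v])\<close> for the cross-ratio \<open>(g h; u v)\<close> becomes
  \<open>(\<beta> \<gamma>) / (\<alpha> \<delta>)\<close>. It does not depend on the choice of coordinates; see
  \<open>line_cross_ratio_eq\<close> below.\<close>

definition line_cross_ratio ::
    "proj_line \<Rightarrow> proj_line \<Rightarrow> proj_line \<Rightarrow> proj_line \<Rightarrow> real" where
  "line_cross_ratio g h u v = (THE r. \<exists>a b \<alpha> \<beta> \<gamma> \<delta>.
     line_coords a g \<and> line_coords b h \<and>
     line_coords (\<alpha> *\<^sub>R a + \<beta> *\<^sub>R b) u \<and> line_coords (\<gamma> *\<^sub>R a + \<delta> *\<^sub>R b) v \<and>
     r = (\<beta> * \<gamma>) / (\<alpha> * \<delta>))"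

definition harmonic_pencil ::
    "proj_line \<Rightarrow> proj_line \<Rightarrow> proj_line \<Rightarrow> proj_line \<Rightarrow> bool" where
  "harmonic_pencil g h u v \<longleftrightarrow>
     distinct [g, h, u, v] \<and>
     (\<exists>P. incident P g \<and> incident P h \<and> incident P u \<and> incident P v) \<and>
     line_cross_ratio g h u v = - 1"


section \<open>The Euclidean part and oriented lengths\<close>

lift_definition affine_point :: "real^2 \<Rightarrow> proj_point" is
  "\<lambda>p. span {vector [p $ 1, p $ 2, 1]}"
proof -
  fix p :: "real^2"
  have "(vector [p $ 1, p $ 2, 1] :: real^3) \<noteq> 0"
    by (metis vector_3(3) zero_index zero_neq_one)
  then show "subspace (span {vector [p $ 1, p $ 2, 1] :: real^3}) \<and>
      dim (span {vector [p $ 1, p $ 2, 1] :: real^3}) = 1"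
    by simp
qed

definition at_infinity_point :: "proj_point \<Rightarrow> bool" where
  "at_infinity_point P \<longleftrightarrow> P \<notin> range affine_point"

definition affine_coords :: "proj_point \<Rightarrow> real^2" where
  "affine_coords P = (THE p. P = affine_point p)"

text \<open>Oriented length of the segment from \<open>p\<close> to \<open>q\<close> on a line with unit direction vector \<open>e\<close>.\<close>

definition oriented_length :: "real^2 \<Rightarrow> real^2 \<Rightarrow> real^2 \<Rightarrow> real" where
  "oriented_length e p q = (q - p) \<bullet> e"

text \<open>The quotient \<open>AX / XB\<close> for distinct Euclidean points \<open>A\<close>, \<open>B\<close> and a point \<open>X\<close> of the line
  \<open>AB\<close>. The line is oriented from \<open>A\<close> to \<open>B\<close>; reversing the orientation does not change the
  quotient.\<close>

definition division_ratio :: "proj_point \<Rightarrow> proj_point \<Rightarrow> proj_point \<Rightarrow> real" where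
  "division_ratio A X B =
     (if at_infinity_point X then - 1
      else let a = affine_coords A; x = affine_coords X; b = affine_coords B; e = sgn (b - a)
           in oriented_length e a x / oriented_length e x b)"


section \<open>Well-definedness\<close>

lemma affine_point_inject: "affine_point p = affine_point q \<longleftrightarrow> p = q"
proof
  assume "affine_point p = affine_point q"
  then have "span {vector [p $ 1, p $ 2, 1] :: real^3} = span {vector [q $ 1, q $ 2, 1]}"
    by transfer
  then have "(vector [p $ 1, p $ 2, 1] :: real^3) \<in> span {vector [q $ 1, q $ 2, 1]}"
    using span_base by blast
  then obtain k where k: "(vector [p $ 1, p $ 2, 1] :: real^3) = k *\<^sub>R vector [q $ 1, q $ 2, 1]"
    by (auto simp: span_singleton)
  from arg_cong[OF k, of "\<lambda>v. v $ 1"] arg_cong[OF k, of "\<lambda>v. v $ 2"] arg_cong[OF k, of "\<lambda>v. v $ 3"]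
  show "p = q"
    by (simp add: vec_eq_iff forall_2)
qed simp

lemma affine_coords_affine_point [simp]: "affine_coords (affine_point p) = p"
  by (simp add: affine_coords_def affine_point_inject)

lemma ex1_meet:
  assumes "g \<noteq> h"
  shows "\<exists>!P. incident P g \<and> incident P h"
  using assms unfolding Ex1_def
proof (transfer)
  fix g h :: "(real^3) set"
  assume g: "subspace g \<and> dim g = 2" and h: "subspace h \<and> dim h = 2" and "g \<noteq> h"
  have sub: "subspace (g \<inter> h)"
    using g h by (simp add: subspace_inter)
  have "dim {x + y |x y. x \<in> g \<and> y \<in> h} + dim (g \<inter> h) = 4"
    using g h dim_sums_Int[of g h] by simp
  moreover have "dim {x + y |x y. x \<in> g \<and> y \<in> h} \<le> 3"
    using dim_subset_UNIV[of "{x + y |x y. x \<in> g \<and> y \<in> h}"] by simp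
  ultimately have "dim (g \<inter> h) \<ge> 1"
    by linarith
  moreover have "dim (g \<inter> h) \<noteq> 2"
  proof
    assume d: "dim (g \<inter> h) = 2"
    have "g \<inter> h = g" "g \<inter> h = h"
      using subspace_dim_equal[OF sub, of g] subspace_dim_equal[OF sub, of h] g h d by auto
    with \<open>g \<noteq> h\<close> show False by simp
  qed
  moreover have "dim (g \<inter> h) \<le> 2"
    using g dim_subset[of "g \<inter> h" g] by auto
  ultimately have d: "dim (g \<inter> h) = 1"
    by linarith
  have uniq: "P = g \<inter> h" if P: "subspace P" "dim P = 1" "P \<subseteq> g" "P \<subseteq> h" for P
  proof (rule subspace_dim_equal)
    show "P \<subseteq> g \<inter> h" using P by blast
    show "dim (g \<inter> h) \<le> dim P" using P d by simp
  qed (use P sub in simp_all)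
  show "\<exists>P\<in>{S. subspace S \<and> dim S = 1}. (P \<subseteq> g \<and> P \<subseteq> h) \<and>
      (\<forall>Q\<in>{S. subspace S \<and> dim S = 1}. Q \<subseteq> g \<and> Q \<subseteq> h \<longrightarrow> Q = P)"
  proof (rule bexI[of _ "g \<inter> h"])
    show "g \<inter> h \<in> {S. subspace S \<and> dim S = 1}"
      using sub d by simp
    show "(g \<inter> h \<subseteq> g \<and> g \<inter> h \<subseteq> h) \<and>
        (\<forall>Q\<in>{S. subspace S \<and> dim S = 1}. Q \<subseteq> g \<and> Q \<subseteq> h \<longrightarrow> Q = g \<inter> h)"
      using uniq by simp
  qed
qed

lemma line_coords_exists: "\<exists>n. line_coords n l"
proof transfer
  fix l :: "(real^3) set"
  assume l: "subspace l \<and> dim l = 2"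
  then have "dim l = DIM(real^3) - 1" by simp
  then obtain n where "n \<noteq> 0" "span l = {x. n \<bullet> x = 0}"
    using lowdim_eq_hyperplane by blast
  then show "\<exists>n. n \<noteq> 0 \<and> l = {x. n \<bullet> x = 0}"
    using l by (metis span_eq_iff)
qed

lemma line_coords_unique:
  assumes "line_coords m l" "line_coords n l"
  shows "\<exists>k. k \<noteq> 0 \<and> m = k *\<^sub>R n"
  using assms
proof transfer
  fix m n :: "real^3" and l
  assume m: "m \<noteq> 0 \<and> l = {x. m \<bullet> x = 0}" and n: "n \<noteq> 0 \<and> l = {x. n \<bullet> x = 0}"
  define k where "k = (m \<bullet> n) / (n \<bullet> n)"
  have nn: "n \<bullet> n \<noteq> 0" using n by simp
  have "n \<bullet> (m - k *\<^sub>R n) = 0"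
    using nn by (simp add: k_def inner_diff_right inner_commute)
  moreover from this have "m \<bullet> (m - k *\<^sub>R n) = 0"
    using m n by blast
  ultimately have "(m - k *\<^sub>R n) \<bullet> (m - k *\<^sub>R n) = 0"
    by (simp add: inner_diff_left)
  then have "m = k *\<^sub>R n" by simp
  then show "\<exists>k. k \<noteq> 0 \<and> m = k *\<^sub>R n"
    using m by (metis scaleR_zero_left)
qed

lemma line_coords_scale: "line_coords n l \<Longrightarrow> k \<noteq> 0 \<Longrightarrow> line_coords (k *\<^sub>R n) l"
  by transfer auto

lemma line_coords_same: "line_coords n l \<Longrightarrow> line_coords n l' \<Longrightarrow> l = l'"
  by transfer auto

lemma pencil_coords_unique:
  fixes a b :: "real^3"
  assumes "line_coords a g" "line_coords b h" "g \<noteq> h"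
    and "\<alpha> *\<^sub>R a + \<beta> *\<^sub>R b = \<gamma> *\<^sub>R a + \<delta> *\<^sub>R b"
  shows "\<alpha> = \<gamma>" "\<beta> = \<delta>"
proof -
  have eq: "(\<alpha> - \<gamma>) *\<^sub>R a = (\<delta> - \<beta>) *\<^sub>R b"
    using assms(4) by (simp add: algebra_simps)
  have nz: "a \<noteq> 0" "b \<noteq> 0"
    using assms(1,2) by (transfer, simp)+
  have "\<alpha> - \<gamma> = 0"
  proof (rule ccontr)
    assume *: "\<alpha> - \<gamma> \<noteq> 0"
    then have "(\<delta> - \<beta>) \<noteq> 0" using eq nz by auto
    then have "line_coords ((\<delta> - \<beta>) *\<^sub>R b) h"
      using assms(2) line_coords_scale by blast
    moreover have "line_coords ((\<delta> - \<beta>) *\<^sub>R b) g"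
      using line_coords_scale[OF assms(1) *] eq by simp
    ultimately show False using assms(3) line_coords_same by blast
  qed
  then show "\<alpha> = \<gamma>" "\<beta> = \<delta>" using eq nz by auto
qed

lemma line_cross_ratio_eq:
  assumes gh: "g \<noteq> h"
    and a: "line_coords a g" and b: "line_coords b h"
    and u: "line_coords (\<alpha> *\<^sub>R a + \<beta> *\<^sub>R b) u" and v: "line_coords (\<gamma> *\<^sub>R a + \<delta> *\<^sub>R b) v"
  shows "line_cross_ratio g h u v = (\<beta> * \<gamma>) / (\<alpha> * \<delta>)"
  unfolding line_cross_ratio_def
proof (rule the_equality)
  show "\<exists>a' b' \<alpha>' \<beta>' \<gamma>' \<delta>'. line_coords a' g \<and> line_coords b' h \<and>
      line_coords (\<alpha>' *\<^sub>R a' + \<beta>' *\<^sub>R b') u \<and> line_coords (\<gamma>' *\<^sub>R a' + \<delta>' *\<^sub>R b') v \<and>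
      (\<beta> * \<gamma>) / (\<alpha> * \<delta>) = (\<beta>' * \<gamma>') / (\<alpha>' * \<delta>')"
    using a b u v by blast
next
  fix r
  assume "\<exists>a b \<alpha> \<beta> \<gamma> \<delta>. line_coords a g \<and> line_coords b h \<and>
      line_coords (\<alpha> *\<^sub>R a + \<beta> *\<^sub>R b) u \<and> line_coords (\<gamma> *\<^sub>R a + \<delta> *\<^sub>R b) v \<and>
      r = (\<beta> * \<gamma>) / (\<alpha> * \<delta>)"
  then obtain a' b' \<alpha>' \<beta>' \<gamma>' \<delta>' where
    a': "line_coords a' g" and b': "line_coords b' h"
    and u': "line_coords (\<alpha>' *\<^sub>R a' + \<beta>' *\<^sub>R b') u"
    and v': "line_coords (\<gamma>' *\<^sub>R a' + \<delta>' *\<^sub>R b') v"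
    and r: "r = (\<beta>' * \<gamma>') / (\<alpha>' * \<delta>')"
    by blast
  obtain s where s: "s \<noteq> 0" "a' = s *\<^sub>R a" using line_coords_unique[OF a' a] by blast
  obtain t where t: "t \<noteq> 0" "b' = t *\<^sub>R b" using line_coords_unique[OF b' b] by blast
  obtain k where k: "k \<noteq> 0" "\<alpha>' *\<^sub>R a' + \<beta>' *\<^sub>R b' = k *\<^sub>R (\<alpha> *\<^sub>R a + \<beta> *\<^sub>R b)"
    using line_coords_unique[OF u' u] by blast
  obtain m where m: "m \<noteq> 0" "\<gamma>' *\<^sub>R a' + \<delta>' *\<^sub>R b' = m *\<^sub>R (\<gamma> *\<^sub>R a + \<delta> *\<^sub>R b)"
    using line_coords_unique[OF v' v] by blast
  have 1: "\<alpha>' * s = k * \<alpha>" "\<beta>' * t = k * \<beta>"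
    using pencil_coords_unique[OF a b gh, of "\<alpha>' * s" "\<beta>' * t" "k * \<alpha>" "k * \<beta>"] k(2) s t
    by (simp_all add: scaleR_add_right)
  have 2: "\<gamma>' * s = m * \<gamma>" "\<delta>' * t = m * \<delta>"
    using pencil_coords_unique[OF a b gh, of "\<gamma>' * s" "\<delta>' * t" "m * \<gamma>" "m * \<delta>"] m(2) s t
    by (simp_all add: scaleR_add_right)
  have "r = ((\<beta>' * t) * (\<gamma>' * s)) / ((\<alpha>' * s) * (\<delta>' * t))"
    using s(1) t(1) by (simp add: r)
  also have "\<dots> = (\<beta> * \<gamma>) / (\<alpha> * \<delta>)"
    using k(1) m(1) by (simp add: 1 2)
  finally show "r = (\<beta> * \<gamma>) / (\<alpha> * \<delta>)" .
qed

end

theory Submission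
  imports Defs
begin

text \<open>Take coordinate vectors \<open>p i\<close> of the vertices and the dual basis \<open>n i\<close>, which consists of
  coordinate vectors of the sides. The harmonic pencil at the vertex \<open>i + 2\<close> then has the form
  \<open>g (i + 2) = n i - t i n (i + 1)\<close>, \<open>h (i + 2) = n i + t i n (i + 1)\<close> with \<open>t i \<noteq> 0\<close>. Three cevians
  \<open>n i - s i n (i + 1)\<close> are concurrent iff \<open>s 1 s 2 s 3 = 1\<close>, and replacing two of the \<open>g\<close> by the
  corresponding \<open>h\<close> changes two signs, so it leaves this product unchanged. Finally, for affine
  vertices with third coordinate 1, the three division ratios are the reciprocals of the \<open>t i\<close>.\<close>

section \<open>Homogeneous coordinates of points\<close>

text \<open>The counterpart of \<open>line_coords\<close> for points: representatives are spanning
  vectors, determined up to a nonzero factor.\<close>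

lift_definition point_coords :: "real^3 \<Rightarrow> proj_point \<Rightarrow> bool" is
  "\<lambda>v S. v \<noteq> 0 \<and> S = span {v}" .

lemma point_coords_exists: "\<exists>v. point_coords v P"
proof transfer
  fix S :: "(real^3) set"
  assume S: "subspace S \<and> dim S = 1"
  then have "\<not> S \<subseteq> {0}"
    using dim_eq_0[of S] by linarith
  then obtain v where v: "v \<in> S" "v \<noteq> 0"
    by blast
  have "span {v} = S"
  proof (rule subspace_dim_equal)
    show "span {v} \<subseteq> S"
      using S v by (simp add: span_minimal)
    show "dim S \<le> dim (span {v})"
      using S v by simp
  qed (use S in simp_all)
  then show "\<exists>v. v \<noteq> 0 \<and> S = span {v}"
    using v by blast
qed

lemma ex_point_coords:
  assumes "v \<noteq> 0"
  shows "\<exists>P. point_coords v P"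
  using assms
proof transfer
  fix v :: "real^3"
  assume "v \<noteq> 0"
  then show "\<exists>S\<in>{S. subspace S \<and> dim S = 1}. v \<noteq> 0 \<and> S = span {v}"
    by (intro bexI[of _ "span {v}"]) simp_all
qed

lemma point_coords_same: "point_coords v P \<Longrightarrow> point_coords v Q \<Longrightarrow> P = Q"
  by transfer auto

lemma point_coords_nonzero: "point_coords v P \<Longrightarrow> v \<noteq> 0"
  by transfer auto

lemma point_coords_scale: "point_coords v P \<Longrightarrow> k \<noteq> 0 \<Longrightarrow> point_coords (k *\<^sub>R v) P"
proof transfer
  fix v :: "real^3" and S and k :: real
  assume *: "v \<noteq> 0 \<and> S = span {v}" "k \<noteq> 0"
  have "span {k *\<^sub>R v} = span {v}"
  proof (rule subspace_dim_equal)
    show "span {k *\<^sub>R v} \<subseteq> span {v}"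
      by (simp add: span_minimal span_base span_scale)
  qed (use * in simp_all)
  with * show "k *\<^sub>R v \<noteq> 0 \<and> S = span {k *\<^sub>R v}"
    by simp
qed

lemma point_coords_unique:
  assumes "point_coords v P" "point_coords w P"
  shows "\<exists>k. k \<noteq> 0 \<and> v = k *\<^sub>R w"
  using assms
proof transfer
  fix v w :: "real^3" and S
  assume v: "v \<noteq> 0 \<and> S = span {v}" and w: "w \<noteq> 0 \<and> S = span {w}"
  then have "v \<in> span {w}"
    using span_base by blast
  then obtain k where "v = k *\<^sub>R w"
    by (auto simp: span_singleton)
  then show "\<exists>k. k \<noteq> 0 \<and> v = k *\<^sub>R w"
    using v by (metis scaleR_zero_left)
qed

lemma incident_iff_inner:
  assumes "point_coords v P" "line_coords n l"
  shows "incident P l \<longleftrightarrow> n \<bullet> v = 0"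
  using assms
proof transfer
  fix v n :: "real^3" and S l
  assume S: "v \<noteq> 0 \<and> S = span {v}" and l: "n \<noteq> 0 \<and> l = {x. n \<bullet> x = 0}"
  have "span {v} \<subseteq> l \<longleftrightarrow> {v} \<subseteq> l"
    using l subspace_hyperplane[of n] span_superset[of "{v}"] span_minimal[of "{v}" l] by blast
  with S l show "S \<subseteq> l \<longleftrightarrow> n \<bullet> v = 0"
    by simp
qed

text \<open>Reduces concurrency to a nontrivial solution of a homogeneous linear system, since a
  common point is the same as a nonzero vector orthogonal to all three coordinate vectors.\<close>

lemma concurrent_iff_inner:
  assumes "line_coords x g" "line_coords y h" "line_coords z k"
  shows "concurrent g h k \<longleftrightarrow> (\<exists>v. v \<noteq> 0 \<and> x \<bullet> v = 0 \<and> y \<bullet> v = 0 \<and> z \<bullet> v = 0)"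
proof
  assume "concurrent g h k"
  then obtain P where P: "incident P g" "incident P h" "incident P k"
    unfolding concurrent_def by blast
  obtain v where "point_coords v P"
    using point_coords_exists by blast
  with P show "\<exists>v. v \<noteq> 0 \<and> x \<bullet> v = 0 \<and> y \<bullet> v = 0 \<and> z \<bullet> v = 0"
    using assms[THEN incident_iff_inner[rotated]] point_coords_nonzero by metis
next
  assume "\<exists>v. v \<noteq> 0 \<and> x \<bullet> v = 0 \<and> y \<bullet> v = 0 \<and> z \<bullet> v = 0"
  then obtain v where v: "v \<noteq> 0" "x \<bullet> v = 0" "y \<bullet> v = 0" "z \<bullet> v = 0"
    by blast
  obtain P where "point_coords v P"
    using ex_point_coords v(1) by blast
  with v show "concurrent g h k"
    unfolding concurrent_def using assms[THEN incident_iff_inner[rotated]] by metis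
qed

section \<open>Harmonic pencils in coordinates\<close>

text \<open>Cross-ratio -1 means \<open>\<beta> * \<gamma> = - (\<alpha> * \<delta>)\<close>; once
  \<open>u\<close> and \<open>v\<close> are scaled to coefficient 1 at \<open>x\<close>, their
  coefficients at \<open>y\<close> are therefore opposite.\<close>

lemma harmonic_pencil_coords:
  assumes harm: "harmonic_pencil g h u v"
    and x: "line_coords x g" and y: "line_coords y h"
    and u: "line_coords (\<alpha> *\<^sub>R x + \<beta> *\<^sub>R y) u" and v: "line_coords (\<gamma> *\<^sub>R x + \<delta> *\<^sub>R y) v"
  shows "\<exists>t. t \<noteq> 0 \<and> line_coords (x - t *\<^sub>R y) u \<and> line_coords (x + t *\<^sub>R y) v"
proof (intro exI conjI)
  have "g \<noteq> h" and "line_cross_ratio g h u v = - 1"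
    using harm by (simp_all add: harmonic_pencil_def)
  then have cr: "(\<beta> * \<gamma>) / (\<alpha> * \<delta>) = - 1"
    using line_cross_ratio_eq[OF _ x y u v] by simp
  \<comment> \<open>Division by zero yields 0, so a vanishing coefficient would make the quotient 0
    instead of -1.\<close>
  then have nz: "\<alpha> \<noteq> 0" "\<beta> \<noteq> 0" "\<gamma> \<noteq> 0" "\<delta> \<noteq> 0"
    by auto
  \<comment> \<open>The witness is \<open>t = - \<beta> / \<alpha>\<close>: scaling the coordinates
    of \<open>u\<close> by \<open>1 / \<alpha>\<close> leaves
    \<open>\<beta> / \<alpha> = - t\<close> at \<open>y\<close>.\<close>
  show "- \<beta> / \<alpha> \<noteq> 0"
    using nz by simp
  have "\<beta> * \<gamma> = - (\<alpha> * \<delta>)"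
    using cr nz by (simp add: field_simps)
  then have "\<delta> / \<gamma> = - \<beta> / \<alpha>"
    using nz by (simp add: field_simps)
  then show "line_coords (x + (- \<beta> / \<alpha>) *\<^sub>R y) v"
    using line_coords_scale[OF v, of "1 / \<gamma>"] nz by (simp add: scaleR_add_right)
  show "line_coords (x - (- \<beta> / \<alpha>) *\<^sub>R y) u"
    using line_coords_scale[OF u, of "1 / \<alpha>"] nz by (simp add: scaleR_add_right)
qed

section \<open>Dual bases and cevians\<close>

text \<open>With the \<open>n i\<close> and \<open>p i\<close> as rows of \<open>N\<close> and
  \<open>P\<close>, duality reads \<open>N ** transpose P = mat 1\<close>. A one-sided inverse of a
  square matrix is two-sided; the reversed product gives the first expansion, its transpose the
  second.\<close>

lemma dual_basis_expansion:
  fixes n p :: "'n::finite \<Rightarrow> real^'n"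
  assumes dual: "\<And>i j. n i \<bullet> p j = (if i = j then 1 else 0)"
  shows "v = (\<Sum>i\<in>UNIV. (n i \<bullet> v) *\<^sub>R p i)" "m = (\<Sum>i\<in>UNIV. (m \<bullet> p i) *\<^sub>R n i)"
proof -
  define N where "N = (\<chi> i. n i)"
  define P where "P = (\<chi> i. p i)"
  have "N ** transpose P = mat 1"
    by (simp add: N_def P_def matrix_matrix_mult_def transpose_def mat_def vec_eq_iff
        dual[unfolded inner_vec_def inner_real_def])
  then have PN: "transpose P ** N = mat 1"
    by (simp add: matrix_left_right_inverse)
  then have NP: "transpose N ** P = mat 1"
    by (metis matrix_transpose_mul transpose_mat transpose_transpose)
  have "transpose P *v (N *v v) = v"
    by (simp add: matrix_vector_mul_assoc PN)
  then show "v = (\<Sum>i\<in>UNIV. (n i \<bullet> v) *\<^sub>R p i)"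
    by (simp add: vec_eq_iff N_def P_def matrix_vector_mult_def transpose_def inner_vec_def
        mult.commute)
  have "transpose N *v (P *v m) = m"
    by (simp add: matrix_vector_mul_assoc NP)
  then show "m = (\<Sum>i\<in>UNIV. (m \<bullet> p i) *\<^sub>R n i)"
    by (simp add: vec_eq_iff N_def P_def matrix_vector_mult_def transpose_def inner_vec_def
        mult.commute)
qed

text \<open>In the basis \<open>p\<close>, a vector \<open>v\<close> has coordinates
  \<open>n i \<bullet> v\<close>. The three equations express each coordinate through the next, and
  going once round the cycle multiplies by \<open>r * s * t\<close>.\<close>

lemma concurrent_cevians_iff:
  fixes n p :: "3 \<Rightarrow> real^3"
  assumes dual: "\<And>i j. n i \<bullet> p j = (if i = j then 1 else 0)"
    and x: "line_coords (n 1 - r *\<^sub>R n 2) x"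
    and y: "line_coords (n 2 - s *\<^sub>R n 3) y"
    and z: "line_coords (n 3 - t *\<^sub>R n 1) z"
  shows "concurrent x y z \<longleftrightarrow> r * s * t = 1"
  unfolding concurrent_iff_inner[OF x y z]
proof
  assume "\<exists>v. v \<noteq> 0 \<and> (n 1 - r *\<^sub>R n 2) \<bullet> v = 0 \<and> (n 2 - s *\<^sub>R n 3) \<bullet> v = 0 \<and>
    (n 3 - t *\<^sub>R n 1) \<bullet> v = 0"
  then obtain v where "v \<noteq> 0" and eqs: "(n 1 - r *\<^sub>R n 2) \<bullet> v = 0" "(n 2 - s *\<^sub>R n 3) \<bullet> v = 0"
    "(n 3 - t *\<^sub>R n 1) \<bullet> v = 0"
    by blast
  have v: "n 1 \<bullet> v = r * (n 2 \<bullet> v)" "n 2 \<bullet> v = s * (n 3 \<bullet> v)" "n 3 \<bullet> v = t * (n 1 \<bullet> v)"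
    using eqs by (simp_all only: inner_diff_left inner_scaleR_left right_minus_eq)
  \<comment> \<open>A zero first coordinate would propagate round the cycle and make all of
    \<open>v\<close> vanish.\<close>
  have "n 1 \<bullet> v \<noteq> 0"
  proof
    assume 1: "n 1 \<bullet> v = 0"
    then have 3: "n 3 \<bullet> v = 0"
      using v(3) by simp
    then have "n 2 \<bullet> v = 0"
      using v(2) by simp
    with 1 3 have "n i \<bullet> v = 0" for i
      using exhaust_3[of i] by auto
    then have "v = 0"
      using dual_basis_expansion(1)[OF dual, of v] by simp
    with \<open>v \<noteq> 0\<close> show False ..
  qed
  moreover have "n 1 \<bullet> v = (r * s * t) * (n 1 \<bullet> v)"
    using v by (metis mult.assoc)
  ultimately show "r * s * t = 1"
    by simp
next
  assume rst: "r * s * t = 1"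
  \<comment> \<open>Set the third coordinate to 1 and solve the first two equations backwards; the
    remaining one becomes \<open>r * s * t = 1\<close>.\<close>
  define v where "v = (r * s) *\<^sub>R p 1 + s *\<^sub>R p 2 + p 3"
  have v: "n 1 \<bullet> v = r * s" "n 2 \<bullet> v = s" "n 3 \<bullet> v = 1"
    by (simp_all add: v_def inner_add_right dual)
  then have "v \<noteq> 0"
    by auto
  with v rst show "\<exists>v. v \<noteq> 0 \<and> (n 1 - r *\<^sub>R n 2) \<bullet> v = 0 \<and> (n 2 - s *\<^sub>R n 3) \<bullet> v = 0 \<and>
    (n 3 - t *\<^sub>R n 1) \<bullet> v = 0"
    by (intro exI[of _ v]) (simp add: inner_diff_left mult.commute)
qed

section \<open>Division ratios\<close>

lemma point_coords_affine_point: "point_coords (vector [q $ 1, q $ 2, 1]) (affine_point q)"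
  by transfer (simp add: vec_eq_iff forall_3)

lemma affine_point_of_coords:
  assumes "point_coords v P" "v $ 3 \<noteq> 0"
  shows "P = affine_point (vector [v $ 1 / v $ 3, v $ 2 / v $ 3])"
proof -
  let ?q = "vector [v $ 1 / v $ 3, v $ 2 / v $ 3] :: real^2"
  have "v = (v $ 3) *\<^sub>R vector [?q $ 1, ?q $ 2, 1]"
    using assms(2) by (simp add: vec_eq_iff forall_3)
  then have "point_coords v (affine_point ?q)"
    using point_coords_scale[OF point_coords_affine_point assms(2), of ?q] by simp
  then show ?thesis
    using assms(1) point_coords_same by blast
qed

lemma at_infinity_point_iff:
  assumes "point_coords v P"
  shows "at_infinity_point P \<longleftrightarrow> v $ 3 = 0"
proof
  assume "at_infinity_point P"
  then show "v $ 3 = 0"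
    using affine_point_of_coords[OF assms] unfolding at_infinity_point_def by blast
next
  assume v: "v $ 3 = 0"
  show "at_infinity_point P"
    unfolding at_infinity_point_def
  proof
    assume "P \<in> range affine_point"
    then obtain q where "P = affine_point q"
      by blast
    then obtain k where "k \<noteq> 0" "v = k *\<^sub>R vector [q $ 1, q $ 2, 1]"
      using point_coords_unique[OF assms] point_coords_affine_point by blast
    then show False
      using v by simp
  qed
qed

text \<open>Allows one choice of representatives to serve both the projective claims, where vertices
  may lie at infinity, and the metric one.\<close>

lemma normalized_point_coords_exists:
  "\<exists>v. point_coords v P \<and> (\<not> at_infinity_point P \<longrightarrow> v $ 3 = 1)"
proof (cases "at_infinity_point P")
  case False
  then obtain q where "P = affine_point q"
    unfolding at_infinity_point_def by blast
  then show ?thesis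
    using point_coords_affine_point[of q] by (metis vector_3(3))
qed (use point_coords_exists in blast)

text \<open>With third coordinates 1, the vector \<open>t *\<^sub>R p + q\<close> represents the
  barycentric combination of \<open>A\<close> and \<open>B\<close> with weights
  \<open>t : 1\<close>, so \<open>X\<close> divides the segment in the ratio
  \<open>1 : t\<close>.\<close>

lemma division_ratio_coords:
  assumes A: "point_coords p A" "p $ 3 = 1" and B: "point_coords q B" "q $ 3 = 1"
    and X: "point_coords (t *\<^sub>R p + q) X" and "A \<noteq> B" "t \<noteq> 0"
  shows "division_ratio A X B = 1 / t"
proof (cases "t = - 1")
  case True
  \<comment> \<open>The third coordinate of \<open>X\<close> is \<open>t + 1 = 0\<close>, and the
    conventional value -1 agrees with \<open>1 / t\<close>.\<close>
  then have "at_infinity_point X"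
    using at_infinity_point_iff[OF X] A B by simp
  then show ?thesis
    using True by (simp add: division_ratio_def)
next
  case False
  then have t: "t + 1 \<noteq> 0"
    by linarith
  define a b x :: "real^2" where "a = vector [p $ 1, p $ 2]" and "b = vector [q $ 1, q $ 2]"
    and "x = vector [(t * p $ 1 + q $ 1) / (t + 1), (t * p $ 2 + q $ 2) / (t + 1)]"
  have pts: "A = affine_point a" "B = affine_point b" "X = affine_point x"
    using affine_point_of_coords[OF A(1)] affine_point_of_coords[OF B(1)]
      affine_point_of_coords[OF X] A(2) B(2) t by (simp_all add: a_def b_def x_def)
  then have fin: "\<not> at_infinity_point X"
    by (simp add: at_infinity_point_def)
  have xa: "x - a = (1 / (t + 1)) *\<^sub>R (b - a)" and bx: "b - x = (t / (t + 1)) *\<^sub>R (b - a)"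
    using t by (simp_all add: vec_eq_iff forall_2 a_def b_def x_def divide_simps)
      (simp_all add: algebra_simps)
  have "a \<noteq> b"
    using pts \<open>A \<noteq> B\<close> by auto
  \<comment> \<open>This inner product is the length of the segment; it cancels from the quotient
    below.\<close>
  then have e: "(b - a) \<bullet> sgn (b - a) \<noteq> 0"
    by (simp add: sgn_div_norm)
  have "division_ratio A X B = ((x - a) \<bullet> sgn (b - a)) / ((b - x) \<bullet> sgn (b - a))"
    using fin by (simp add: division_ratio_def oriented_length_def Let_def pts)
  also have "\<dots> = 1 / t"
    unfolding xa bx using e t \<open>t \<noteq> 0\<close> by simp
  finally show ?thesis .
qed

text \<open>The intersection is represented by \<open>t *\<^sub>R p + q\<close>: \<open>m\<close>
  annihilates both \<open>p\<close> and \<open>q\<close>, and \<open>c\<close> takes the value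
  \<open>t - t = 0\<close> there.\<close>

lemma division_ratio_cevian:
  assumes A: "point_coords p A" "p $ 3 = 1" and B: "point_coords q B" "q $ 3 = 1" and "A \<noteq> B"
    and m: "line_coords m l" "m \<bullet> p = 0" "m \<bullet> q = 0"
    and c: "line_coords c k" "c \<bullet> p = 1" "c \<bullet> q = - t" and "t \<noteq> 0"
  shows "division_ratio A (meet l k) B = 1 / t"
proof -
  have "t *\<^sub>R p + q \<noteq> 0"
  proof
    assume 0: "t *\<^sub>R p + q = 0"
    from arg_cong[OF 0, of "\<lambda>v. v $ 3"] have "t = - 1"
      using A(2) B(2) by simp
    with 0 have "q = p"
      by simp
    then show False
      using A(1) B(1) \<open>A \<noteq> B\<close> point_coords_same by blast
  qed
  then obtain X where X: "point_coords (t *\<^sub>R p + q) X"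
    using ex_point_coords by blast
  have "incident X l" "incident X k"
    using incident_iff_inner[OF X] m c by (simp_all add: inner_add_right)
  \<comment> \<open>The vertex \<open>A\<close> lies on \<open>l\<close> but not on
    \<open>k\<close>, which makes the lines distinct and \<open>meet\<close> well defined.\<close>
  moreover have "incident A l" "\<not> incident A k"
    using incident_iff_inner[OF A(1)] m c by simp_all
  then have "l \<noteq> k"
    by auto
  ultimately have "meet l k = X"
    unfolding meet_def using ex1_meet by (intro the1_equality ex1_meet conjI)
  then show ?thesis
    using division_ratio_coords[OF A B X \<open>A \<noteq> B\<close> \<open>t \<noteq> 0\<close>] by simp
qed

section \<open>Reduction of the triangle to one equation between the pencil parameters\<close>

text \<open>Numerals in type \<open>3\<close> count modulo 3; these rules fold the sums
  \<open>i + 1\<close> and \<open>i + 2\<close> that exceed 3 back to vertex indices.\<close>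

lemma index_mod_3 [simp]: "(4::3) = 1" "(5::3) = 2"
  by simp_all

lemma concurrent_rotate: "concurrent g h k \<longleftrightarrow> concurrent h k g"
  unfolding concurrent_def by blast

theorem theorem6:
  fixes A :: "3 \<Rightarrow> proj_point" and a g h :: "3 \<Rightarrow> proj_line"
  assumes sides: "\<And>i j. j \<noteq> i \<Longrightarrow> incident (A j) (a i)"
    and triangle: "\<And>i. \<not> incident (A i) (a i)"
    and through: "\<And>i. incident (A i) (g i)" "\<And>i. incident (A i) (h i)"
    and harmonic: "\<And>i. harmonic_pencil (a i) (a (i + 1)) (g (i + 2)) (h (i + 2))"
  shows
    \<comment> \<open>(i)\<close>
    "(concurrent (g 1) (g 2) (g 3) \<longrightarrow>
       (\<forall>i. concurrent (g i) (h (i + 1)) (h (i + 2)))) \<and>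
     \<comment> \<open>(ii)\<close>
     (\<forall>i. concurrent (g i) (h (i + 1)) (h (i + 2)) \<longrightarrow>
       (\<forall>j. concurrent (g j) (h (j + 1)) (h (j + 2))) \<and> concurrent (g 1) (g 2) (g 3)) \<and>
     \<comment> \<open>(iii)\<close>
     ((\<forall>i. \<not> at_infinity_point (A i)) \<longrightarrow>
       (let B = (\<lambda>i. meet (a i) (g i));
            ceva = (division_ratio (A 1) (B 3) (A 2) * division_ratio (A 2) (B 1) (A 3) *
                    division_ratio (A 3) (B 2) (A 1) = 1)
        in (concurrent (g 1) (g 2) (g 3) \<longleftrightarrow> ceva) \<and>
           (\<forall>i. concurrent (g i) (h (i + 1)) (h (i + 2)) \<longleftrightarrow> ceva)))"
proof -
  have "\<forall>i. \<exists>v. point_coords v (A i) \<and> (\<not> at_infinity_point (A i) \<longrightarrow> v $ 3 = 1)"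
    using normalized_point_coords_exists by blast
  from choice[OF this] obtain p where p: "\<And>i. point_coords (p i) (A i)"
    and p3: "\<And>i. \<not> at_infinity_point (A i) \<Longrightarrow> p i $ 3 = 1"
    by blast
  have "\<forall>i. \<exists>m. line_coords m (a i)"
    using line_coords_exists by blast
  from choice[OF this] obtain m where m: "\<And>i. line_coords (m i) (a i)"
    by blast
  \<comment> \<open>The scaling makes the side coordinates dual to \<open>p\<close>. The divisor is
    nonzero because \<open>A i\<close> is off \<open>a i\<close>; the off-diagonal products vanish
    because the other two vertices lie on \<open>a i\<close>.\<close>
  define n where "n i = (1 / (m i \<bullet> p i)) *\<^sub>R m i" for i
  have mp: "m i \<bullet> p i \<noteq> 0" for i
    using triangle incident_iff_inner[OF p m] by blast
  have n: "line_coords (n i) (a i)" for i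
    unfolding n_def using m mp by (simp add: line_coords_scale)
  have dual: "n i \<bullet> p j = (if i = j then 1 else 0)" for i j
    using mp sides[of j i] incident_iff_inner[OF p m, of j i] by (auto simp: n_def)
  \<comment> \<open>A line through \<open>A (i + 2)\<close> has coefficient
    \<open>c \<bullet> p (i + 2) = 0\<close> at \<open>n (i + 2)\<close>, so only the two sides
    through that vertex contribute.\<close>
  have through_coords: "line_coords ((c \<bullet> p i) *\<^sub>R n i + (c \<bullet> p (i + 1)) *\<^sub>R n (i + 1)) l"
    if c: "line_coords c l" and l: "incident (A (i + 2)) l" for c l i
  proof -
    have "c \<bullet> p (i + 2) = 0"
      using incident_iff_inner[OF p c] l by blast
    then have "c = (c \<bullet> p i) *\<^sub>R n i + (c \<bullet> p (i + 1)) *\<^sub>R n (i + 1)"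
      using dual_basis_expansion(2)[OF dual, of c] exhaust_3[of i]
      by (auto simp: sum_3 add.commute)
    with c show ?thesis by simp
  qed
  have "\<forall>i. \<exists>t. t \<noteq> 0 \<and> line_coords (n i - t *\<^sub>R n (i + 1)) (g (i + 2)) \<and>
      line_coords (n i + t *\<^sub>R n (i + 1)) (h (i + 2))"
  proof
    fix i
    obtain u v where "line_coords u (g (i + 2))" "line_coords v (h (i + 2))"
      using line_coords_exists by blast
    note this[THEN through_coords]
    from harmonic_pencil_coords[OF harmonic n n this(1)[OF through(1)] this(2)[OF through(2)]]
    show "\<exists>t. t \<noteq> 0 \<and> line_coords (n i - t *\<^sub>R n (i + 1)) (g (i + 2)) \<and>
      line_coords (n i + t *\<^sub>R n (i + 1)) (h (i + 2))" .
  qed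
  from choice[OF this] obtain t where t: "\<And>i. t i \<noteq> 0"
    and g: "\<And>i. line_coords (n i - t i *\<^sub>R n (i + 1)) (g (i + 2))"
    and h: "\<And>i. line_coords (n i + t i *\<^sub>R n (i + 1)) (h (i + 2))"
    by blast
  \<comment> \<open>The parameter \<open>t i\<close> belongs to the vertex \<open>i + 2\<close>, so
    the lines appear in the order 3, 1, 2; \<open>concurrent_rotate\<close> later restores the order
    of the claim.\<close>
  have g': "line_coords (n 1 - t 1 *\<^sub>R n 2) (g 3)" "line_coords (n 2 - t 2 *\<^sub>R n 3) (g 1)"
      "line_coords (n 3 - t 3 *\<^sub>R n 1) (g 2)"
    using g[of 1] g[of 2] g[of 3] by simp_all
  \<comment> \<open>Each \<open>h\<close> is written as a cevian with parameter
    \<open>- t i\<close>, so that the same criterion covers mixed triples.\<close>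
  have h': "line_coords (n 1 - (- t 1) *\<^sub>R n 2) (h 3)" "line_coords (n 2 - (- t 2) *\<^sub>R n 3) (h 1)"
      "line_coords (n 3 - (- t 3) *\<^sub>R n 1) (h 2)"
    using h[of 1] h[of 2] h[of 3] by simp_all
  have ggg: "concurrent (g 1) (g 2) (g 3) \<longleftrightarrow> t 1 * t 2 * t 3 = 1"
    using concurrent_cevians_iff[OF dual g'] concurrent_rotate by metis
  \<comment> \<open>Every mixed triple contains exactly two of the \<open>h\<close>, so the two
    signs cancel in the product.\<close>
  have "concurrent (g 1) (h 2) (h 3) \<longleftrightarrow> t 1 * t 2 * t 3 = 1"
    "concurrent (g 2) (h 3) (h 1) \<longleftrightarrow> t 1 * t 2 * t 3 = 1"
    "concurrent (g 3) (h 1) (h 2) \<longleftrightarrow> t 1 * t 2 * t 3 = 1"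
    using concurrent_cevians_iff[OF dual h'(1) g'(2) h'(3)]
      concurrent_cevians_iff[OF dual h'(1,2) g'(3)]
      concurrent_cevians_iff[OF dual g'(1) h'(2,3)] concurrent_rotate
    by simp_all metis+
  then have ghh: "concurrent (g i) (h (i + 1)) (h (i + 2)) \<longleftrightarrow> t 1 * t 2 * t 3 = 1" for i
    using exhaust_3[of i] by auto
  have ratios: "division_ratio (A 1) (meet (a 3) (g 3)) (A 2) *
      division_ratio (A 2) (meet (a 1) (g 1)) (A 3) *
      division_ratio (A 3) (meet (a 2) (g 2)) (A 1) = 1 \<longleftrightarrow> t 1 * t 2 * t 3 = 1"
    if fin: "\<And>i. \<not> at_infinity_point (A i)"
  proof -
    have ne: "A i \<noteq> A j" if "i \<noteq> j" for i j
      using sides triangle that by metis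
    \<comment> \<open>For the side \<open>a 3\<close>, say, \<open>n 3\<close> annihilates
      \<open>p 1\<close> and \<open>p 2\<close>, while \<open>n 1 - t 1 *\<^sub>R n 2\<close> takes
      the values 1 and \<open>- t 1\<close> on them; the other sides follow cyclically.\<close>
    note ratio = division_ratio_cevian[OF p p3[OF fin] p p3[OF fin] ne n]
    have eqs: "division_ratio (A 1) (meet (a 3) (g 3)) (A 2) = 1 / t 1"
      "division_ratio (A 2) (meet (a 1) (g 1)) (A 3) = 1 / t 2"
      "division_ratio (A 3) (meet (a 2) (g 2)) (A 1) = 1 / t 3"
      by (rule ratio[OF _ _ _ g'(1)] ratio[OF _ _ _ g'(2)] ratio[OF _ _ _ g'(3)];
          simp add: dual inner_diff_left t)+
    show ?thesis
      unfolding eqs using t by (auto simp: divide_simps)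
  qed
  \<comment> \<open>All four concurrencies, and for affine vertices the ratio condition, are now
    equivalent to the single equation \<open>t 1 * t 2 * t 3 = 1\<close>.\<close>
  show ?thesis
    unfolding Let_def using ggg ghh ratios by blast
qed

end
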